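(* Let $r\ge 1$, $X=\{1,2,\ldots,r\}$, and let $U$ and $V$ be two relations on $X$. The following conditions are equivalent. (i) The statistics $\mathrm{maj}'_U+\mathrm{inv}'_V$ and $\mathrm{inv}'_{U\cup V}$ are equidistributed on each rearrangement class $\mathcal R(\mathbf c)$. (ii) $U\cap V=\emptyset$ and $U\cup V$ is a $\kappa$-extension of $U$.
   Context: $X=\{1,\ldots,r\}$ and $X^*$ is the set of finite words with letters in $X$. A relation on $X$ is a subset of $X\times X$; $x\,U\,y$ means $(x,y)\in U$. $\chi(P)=1$ if $P$ is true and $0$ otherwise. For a relation $U$ and a word $w=x_1\cdots x_n$, $\mathrm{inv}'_U(w)=\sum_{1\le i<j\le n}\chi(x_i\,U\,x_j)$ and $\mathrm{maj}'_U(w)=\sum_{i=1}^{n-1} i\,\chi(x_i\,U\,x_{i+1})$. For a sequence $\mathbf c=(c(1),\ldots,c(r))$ of non-negative integers, $\mathcal R(\mathbf c)$ is the set of all words obtained by permuting the letters of $1^{c(1)}2^{c(2)}\cdots r^{c(r)}$. Two statistics $s,t:X^*\to\mathbb Z_{\ge0}$ are equidistributed on a set $R$ of words if $\sum_{w\in R}q^{s(w)}=\sum_{w\in R}q^{t(w)}$. A relation $S$ on $X$ is a $\kappa$-extension of a relation $U$ on $X$ if (1) $U\subseteq S$ and (2) for all $x,y,z\in X$: if $(x,y)\in U$ and $(z,y)\notin U$, then $(x,z)\in S$ and $(z,x)\notin S$. *)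

theory Defs
  imports "HOL-Combinatorics.Multiset_Permutations" "HOL-Computational_Algebra.Polynomial"
begin

text \<open>
  Letters are natural numbers, words are lists, and a relation on \<open>X\<close> is a set of pairs
  contained in \<open>X \<times> X\<close>. Positions in words are numbered from 1, so the letter
  $x_i$ of \<open>w\<close> is \<open>w ! (i - 1)\<close>.
\<close>

definition inv_stat :: "('a \<times> 'a) set \<Rightarrow> 'a list \<Rightarrow> nat" where
  "inv_stat U w =
     (\<Sum>(i, j) \<in> {(i, j). 1 \<le> i \<and> i < j \<and> j \<le> length w}.
        of_bool ((w ! (i - 1), w ! (j - 1)) \<in> U))"

definition maj_stat :: "('a \<times> 'a) set \<Rightarrow> 'a list \<Rightarrow> nat" where
  "maj_stat U w = (\<Sum>i \<in> {1..<length w}. i * of_bool ((w ! (i - 1), w ! i) \<in> U))"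

definition rearrangement_class :: "nat \<Rightarrow> (nat \<Rightarrow> nat) \<Rightarrow> nat list set" where
  "rearrangement_class r c =
     permutations_of_multiset (\<Sum>i \<in> {1..r}. replicate_mset (c i) i)"

text \<open>
  The generating functions are compared as polynomials in the indeterminate \<open>q\<close>:
  \<open>monom 1 k\<close> is $q^k$. The sums are meaningful for finite \<open>R\<close>, such as rearrangement classes.
\<close>

definition equidistributed_on :: "'a list set \<Rightarrow> ('a list \<Rightarrow> nat) \<Rightarrow> ('a list \<Rightarrow> nat) \<Rightarrow> bool" where
  "equidistributed_on R s t \<longleftrightarrow>
     (\<Sum>w\<in>R. monom (1::int) (s w)) = (\<Sum>w\<in>R. monom (1::int) (t w))"

definition kappa_extension :: "'a set \<Rightarrow> ('a \<times> 'a) set \<Rightarrow> ('a \<times> 'a) set \<Rightarrow> bool" where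
  "kappa_extension X S U \<longleftrightarrow>
     U \<subseteq> S \<and>
     (\<forall>x\<in>X. \<forall>y\<in>X. \<forall>z\<in>X.
        (x, y) \<in> U \<and> (z, y) \<notin> U \<longrightarrow> (x, z) \<in> S \<and> (z, x) \<notin> S)"

end

theory Submission imports Defs begin

text \<open>
  The implication from (ii) to (i) is Foata's second fundamental transformation. When a letter
  \<open>y\<close> is appended to a word, the word is cut into blocks ending in a letter that agrees
  with the last one as to being \<open>U\<close>-related to \<open>y\<close>, and the final letter of every
  block is moved to its front. The \<open>\<kappa>\<close>-condition says that every such move past a
  letter changes the number of \<open>S\<close>-inversions, \<open>S = U \<union> V\<close>, by exactly one,
  in the direction needed to turn the contribution of \<open>y\<close> to \<open>maj'\<^sub>U + inv'\<^sub>V\<close>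
  into its contribution to \<open>inv'\<^sub>S\<close>.

  Conversely, the first moments of the two statistics on classes of two-letter words force
  \<open>U\<close> and \<open>V\<close> to be disjoint. On a class of three-letter words the difference of the
  second moments is then a sum of non-negative terms, each of which vanishes exactly if an instance
  of the \<open>\<kappa>\<close>-condition holds.
\<close>

section \<open>Recursions for the two statistics when a letter is added\<close>

lemma inv_stat_Nil [simp]: "inv_stat S [] = 0"
proof -
  have "{(i::nat, j). 1 \<le> i \<and> i < j \<and> j \<le> length ([]::'a list)} = {}" by auto
  then show ?thesis unfolding inv_stat_def by (simp only: sum.empty)
qed

lemma inv_stat_snoc:
  "inv_stat S (w @ [y]) = inv_stat S w + length (filter (\<lambda>x. (x, y) \<in> S) w)"
proof -
  let ?f = "\<lambda>(i, j). of_bool (((w @ [y]) ! (i - 1), (w @ [y]) ! (j - 1)) \<in> S) :: nat"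
  let ?A = "{(i, j). 1 \<le> i \<and> i < j \<and> j \<le> length w}"
  let ?B = "(\<lambda>i. (Suc i, Suc (length w))) ` {..<length w}"
  have fin: "finite ?A"
    by (rule finite_subset[of _ "{..length w} \<times> {..length w}"]) auto
  have split: "{(i, j). 1 \<le> i \<and> i < j \<and> j \<le> length (w @ [y])} = ?A \<union> ?B"
  proof (intro equalityI subsetI)
    fix p assume "p \<in> {(i, j). 1 \<le> i \<and> i < j \<and> j \<le> length (w @ [y])}"
    then obtain i j where p: "p = (i, j)" "1 \<le> i" "i < j" "j \<le> Suc (length w)" by auto
    show "p \<in> ?A \<union> ?B"
    proof (cases "j \<le> length w")
      case False
      then have "p = (\<lambda>i. (Suc i, Suc (length w))) (i - 1)" "i - 1 \<in> {..<length w}"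
        using p by auto
      then show ?thesis by blast
    qed (use p in auto)
  qed auto
  have "inv_stat S (w @ [y]) = sum ?f ?A + sum ?f ?B"
    unfolding inv_stat_def split by (rule sum.union_disjoint) (use fin in auto)
  also have "sum ?f ?A = inv_stat S w"
    unfolding inv_stat_def by (rule sum.cong) (auto simp: nth_append)
  also have "sum ?f ?B = (\<Sum>i<length w. of_bool ((w ! i, y) \<in> S))"
    by (subst sum.reindex) (auto simp: inj_on_def nth_append intro!: sum.cong)
  also have "\<dots> = length (filter (\<lambda>x. (x, y) \<in> S) w)"
    by (simp add: length_filter_conv_card of_bool_def sum.If_cases Int_def)
  finally show ?thesis .
qed

text \<open>Needed beside the version for an appended letter because \<open>hop\<close> recurses at
  the front of a word, whereas \<open>foata\<close> appends at its end.\<close>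

lemma inv_stat_Cons:
  "inv_stat S (x # w) = length (filter (\<lambda>y. (x, y) \<in> S) w) + inv_stat S w"
proof (induction w rule: rev_induct)
  case Nil
  show ?case using inv_stat_snoc[of S "[]" x] by simp
next
  case (snoc y w)
  then show ?case using inv_stat_snoc[of S "x # w" y] inv_stat_snoc[of S w y] by simp
qed

lemma maj_stat_Nil [simp]: "maj_stat U [] = 0"
  by (simp add: maj_stat_def)

lemma maj_stat_single [simp]: "maj_stat U [x] = 0"
  by (simp add: maj_stat_def)

lemma maj_stat_snoc:
  assumes "w \<noteq> []"
  shows "maj_stat U (w @ [y]) = maj_stat U w + length w * of_bool ((last w, y) \<in> U)"
proof -
  let ?f = "\<lambda>i. i * of_bool (((w @ [y]) ! (i - 1), (w @ [y]) ! i) \<in> U) :: nat"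
  have "maj_stat U (w @ [y]) = sum ?f {1..<Suc (length w)}"
    by (simp add: maj_stat_def)
  also have "\<dots> = sum ?f {1..<length w} + ?f (length w)"
    using assms by (subst sum.atLeastLessThan_Suc) (auto simp: Suc_le_eq)
  also have "sum ?f {1..<length w} = maj_stat U w"
    unfolding maj_stat_def by (rule sum.cong) (auto simp: nth_append)
  also have "?f (length w) = length w * of_bool ((last w, y) \<in> U)"
    using assms by (simp add: nth_append last_conv_nth)
  finally show ?thesis .
qed

section \<open>Equidistribution and rearrangement classes in terms of multisets\<close>

lemma image_mset_eq_iff_equidistributed:
  assumes "finite R"
  shows "equidistributed_on R s t
           \<longleftrightarrow> image_mset s (mset_set R) = image_mset t (mset_set R)"
proof -
  have "coeff (\<Sum>w\<in>R. monom (1::int) (f w)) k = int (count (image_mset f (mset_set R)) k)"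
    for f :: "'a list \<Rightarrow> nat" and k
    using assms
    by (auto simp: coeff_sum count_image_mset sum.If_cases Int_def vimage_def
        intro!: arg_cong[where f = card])
  then show ?thesis
    by (auto simp: equidistributed_on_def poly_eq_iff multiset_eq_iff)
qed

text \<open>Used with \<open>f\<close> the identity and the square, to compare first and second
  moments.\<close>

lemma equidistributed_on_sum_eq:
  fixes f :: "nat \<Rightarrow> int"
  assumes "equidistributed_on R s t" "finite R"
  shows "(\<Sum>w\<in>R. f (s w)) = (\<Sum>w\<in>R. f (t w))"
proof -
  have "image_mset f (image_mset s (mset_set R)) = image_mset f (image_mset t (mset_set R))"
    using assms by (simp only: image_mset_eq_iff_equidistributed)
  then show ?thesis
    by (simp add: sum_unfold_sum_mset multiset.map_comp comp_def)
qed

lemma rearrangement_class_count: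
  assumes "set_mset M \<subseteq> {1..r}"
  shows "rearrangement_class r (count M) = permutations_of_multiset M"
proof -
  have "(\<Sum>i\<in>{1..r}. replicate_mset (count M i) i) = M"
  proof (rule multiset_eqI)
    fix x
    have "x \<notin># M" if "x \<notin> {1..r}" using that assms by blast
    then show "count (\<Sum>i\<in>{1..r}. replicate_mset (count M i) i) x = count M x"
      by (auto simp: count_sum not_in_iff)
  qed
  then show ?thesis by (simp add: rearrangement_class_def)
qed

lemma set_mset_rearrangement:
  "set_mset (\<Sum>i\<in>{1..r::nat}. replicate_mset (c i) i) \<subseteq> {1..r}"
  by (subst set_mset_sum) (auto split: if_splits)

section \<open>The transformation\<close>

text \<open>
  If the last letter of the word satisfies \<open>P\<close>, then \<open>hop P\<close> cuts the word after each
  letter satisfying \<open>P\<close> and moves the last letter of each block to its front.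
\<close>

fun hop :: "('a \<Rightarrow> bool) \<Rightarrow> 'a list \<Rightarrow> 'a list" where
  "hop P [] = []"
| "hop P (z # w) =
     (if P z then z # hop P w else case hop P w of [] \<Rightarrow> [z] | x # v \<Rightarrow> x # z # v)"

lemma mset_hop [simp]: "mset (hop P w) = mset w"
proof (induction w)
  case (Cons z w)
  then show ?case by (cases "hop P w") auto
qed simp

lemma set_hop [simp]: "set (hop P w) = set w"
  by (metis mset_hop set_mset_mset)

lemma hop_eq_Nil_iff [simp]: "hop P w = [] \<longleftrightarrow> w = []"
  by (metis mset_hop mset_zero_iff)

lemma hd_hop: "w \<noteq> [] \<Longrightarrow> P (last w) \<Longrightarrow> P (hd (hop P w))"
proof (induction w)
  case (Cons z w)
  then show ?case by (cases "w = []") (auto split: list.split)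
qed simp

text \<open>The second letter of the image reveals which clause of \<open>hop\<close> was applied.
  If \<open>P z\<close>, what follows \<open>z\<close> is empty or begins with a letter satisfying
  \<open>P\<close>, by \<open>hd_hop\<close>; otherwise the second letter is \<open>z\<close>
  itself. So \<open>z\<close> and the image of the tail can be recovered.\<close>

lemma hop_inject:
  assumes "w \<noteq> [] \<Longrightarrow> P (last w)" "w' \<noteq> [] \<Longrightarrow> P (last w')" "hop P w = hop P w'"
  shows "w = w'"
  using assms
proof (induction w arbitrary: w')
  case Nil
  then show ?case by (metis hop_eq_Nil_iff)
next
  case (Cons z w)
  have "w' \<noteq> []" using Cons.prems(3) by (metis hop_eq_Nil_iff list.distinct(1))
  then obtain z' v where w': "w' = z' # v" by (cases w') auto
  have lw: "P (last w)" if "w \<noteq> []" using Cons.prems(1) that by simp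
  have lv: "P (last v)" if "v \<noteq> []" using Cons.prems(2) that w' by simp
  have hw: "P (hd (hop P w))" if "w \<noteq> []" using hd_hop that lw by blast
  have hv: "P (hd (hop P v))" if "v \<noteq> []" using hd_hop that lv by blast
  have "w \<noteq> []" if "\<not> P z" using that Cons.prems(1) by auto
  then have nz: "\<exists>x u. hop P w = x # u" if "\<not> P z" using that by (metis hop_eq_Nil_iff neq_Nil_conv)
  have "v \<noteq> []" if "\<not> P z'" using that Cons.prems(2) w' by auto
  then have nz': "\<exists>x u. hop P v = x # u" if "\<not> P z'"
    using that by (metis hop_eq_Nil_iff neq_Nil_conv)
  have eq: "hop P (z # w) = hop P (z' # v)" using Cons.prems(3) w' by simp
  have "z = z' \<and> hop P w = hop P v"
  proof (cases "P z"; cases "P z'")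
    assume "P z" "P z'"
    then show ?thesis using eq by simp
  next
    assume z: "P z" "\<not> P z'"
    then obtain x u where "hop P v = x # u" using nz' by blast
    then have *: "hop P w = z' # u" using eq z by simp
    then have "w \<noteq> []" by auto
    then show ?thesis using hw * z by simp
  next
    assume z: "\<not> P z" "P z'"
    then obtain x u where "hop P w = x # u" using nz by blast
    then have *: "hop P v = z # u" using eq z by simp
    then have "v \<noteq> []" by auto
    then show ?thesis using hv * z by simp
  next
    assume z: "\<not> P z" "\<not> P z'"
    then obtain x u x' u' where "hop P w = x # u" "hop P v = x' # u'" using nz nz' by metis
    then show ?thesis using eq z by simp
  qed
  then show ?case using Cons.IH[of v] lw lv w' by blast
qed

lemma length_filter_hop [simp]: "length (filter Q (hop P w)) = length (filter Q w)"
  by (metis mset_filter mset_hop size_mset)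

text \<open>In the recursion a letter \<open>z\<close> failing \<open>P\<close> changes order with
  exactly one letter: the head \<open>x\<close> of the hopped tail, which satisfies
  \<open>P\<close>. This creates exactly one inversion, so the gain is the number of such
  \<open>z\<close>.\<close>

lemma inv_stat_hop_up:
  assumes "w \<noteq> [] \<Longrightarrow> P (last w)"
    and "\<And>x z. x \<in> set w \<Longrightarrow> z \<in> set w \<Longrightarrow> P x \<Longrightarrow> \<not> P z \<Longrightarrow> (x, z) \<in> S \<and> (z, x) \<notin> S"
  shows "inv_stat S (hop P w) = inv_stat S w + length (filter (\<lambda>z. \<not> P z) w)"
  using assms
proof (induction w)
  case (Cons z w)
  have IH: "inv_stat S (hop P w) = inv_stat S w + length (filter (\<lambda>z. \<not> P z) w)"
    using Cons.prems by (intro Cons.IH) auto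
  show ?case
  proof (cases "P z")
    case True
    then show ?thesis using IH by (simp add: inv_stat_Cons)
  next
    case False
    then have w: "w \<noteq> []" "P (last w)" using Cons.prems(1) by (auto split: if_splits)
    then obtain x v where xv: "hop P w = x # v" by (metis hop_eq_Nil_iff neq_Nil_conv)
    have "P x" using hd_hop[of w P] w xv by simp
    moreover have "x \<in> set w" by (metis xv list.set_intros(1) set_hop)
    ultimately have "(x, z) \<in> S" "(z, x) \<notin> S" using Cons.prems(2)[of x z] False by auto
    moreover have "length (filter (\<lambda>y. (z, y) \<in> S) (x # v)) = length (filter (\<lambda>y. (z, y) \<in> S) w)"
      by (metis xv length_filter_hop)
    ultimately show ?thesis using False xv IH by (simp add: inv_stat_Cons)
  qed
qed simp

lemma inv_stat_hop_down:
  assumes "w \<noteq> [] \<Longrightarrow> P (last w)"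
    and "\<And>x z. x \<in> set w \<Longrightarrow> z \<in> set w \<Longrightarrow> P x \<Longrightarrow> \<not> P z \<Longrightarrow> (z, x) \<in> S \<and> (x, z) \<notin> S"
  shows "inv_stat S (hop P w) + length (filter (\<lambda>z. \<not> P z) w) = inv_stat S w"
  using assms
proof (induction w)
  case (Cons z w)
  have IH: "inv_stat S (hop P w) + length (filter (\<lambda>z. \<not> P z) w) = inv_stat S w"
    using Cons.prems by (intro Cons.IH) auto
  show ?case
  proof (cases "P z")
    case True
    then show ?thesis using IH by (simp add: inv_stat_Cons)
  next
    case False
    then have w: "w \<noteq> []" "P (last w)" using Cons.prems(1) by (auto split: if_splits)
    then obtain x v where xv: "hop P w = x # v" by (metis hop_eq_Nil_iff neq_Nil_conv)
    have "P x" using hd_hop[of w P] w xv by simp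
    moreover have "x \<in> set w" by (metis xv list.set_intros(1) set_hop)
    ultimately have "(z, x) \<in> S" "(x, z) \<notin> S" using Cons.prems(2)[of x z] False by auto
    moreover have "length (filter (\<lambda>y. (z, y) \<in> S) (x # v)) = length (filter (\<lambda>y. (z, y) \<in> S) w)"
      by (metis xv length_filter_hop)
    ultimately show ?thesis using False xv IH by (simp add: inv_stat_Cons)
  qed
qed simp

text \<open>Comparing with the last letter makes that letter satisfy the predicate given to
  \<open>hop\<close>, so the last block is always complete.\<close>

definition hop_last :: "('a \<Rightarrow> bool) \<Rightarrow> 'a list \<Rightarrow> 'a list" where
  "hop_last P w = hop (\<lambda>x. P x = P (last w)) w"

lemma mset_hop_last [simp]: "mset (hop_last P w) = mset w"
  by (simp add: hop_last_def)

text \<open>The predicate given to \<open>hop\<close> depends on the word, but only through the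
  truth value of \<open>P\<close> at its last letter, and the first letter of the image has the same
  truth value.\<close>

lemma hop_last_inject:
  assumes "hop_last P w = hop_last P w'"
  shows "w = w'"
proof (cases "w = []")
  case True
  then show ?thesis using assms by (metis mset_hop_last mset_zero_iff)
next
  case False
  then have ne: "w' \<noteq> []" using assms by (metis mset_hop_last mset_zero_iff)
  have "P (hd (hop_last P w)) = P (last w)" "P (hd (hop_last P w')) = P (last w')"
    using hd_hop[of w "\<lambda>x. P x = P (last w)"] hd_hop[of w' "\<lambda>x. P x = P (last w')"] False ne
    by (auto simp: hop_last_def)
  then have "P (last w) = P (last w')" using assms by simp
  then show ?thesis
    using hop_inject[of w "\<lambda>x. P x = P (last w)" w'] assms by (simp add: hop_last_def)
qed

text \<open>The argument is the word read from right to left.\<close>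

fun foata :: "('a \<times> 'a) set \<Rightarrow> 'a list \<Rightarrow> 'a list" where
  "foata U [] = []"
| "foata U (y # w) = hop_last (\<lambda>x. (x, y) \<in> U) (foata U w) @ [y]"

lemma mset_foata [simp]: "mset (foata U w) = mset w"
  by (induction w) auto

lemma last_foata: "w \<noteq> [] \<Longrightarrow> last (foata U w) = hd w"
  by (cases w) auto

lemma foata_inject: "foata U w = foata U w' \<Longrightarrow> w = w'"
proof (induction w arbitrary: w')
  case Nil
  then show ?case by (metis mset_foata mset_zero_iff)
next
  case (Cons y w)
  have "w' \<noteq> []" using Cons.prems by (metis mset_foata mset_zero_iff list.distinct(1))
  then obtain y' v where w': "w' = y' # v" by (cases w') auto
  then have "y = y'" "hop_last (\<lambda>x. (x, y) \<in> U) (foata U w) = hop_last (\<lambda>x. (x, y) \<in> U) (foata U v)"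
    using Cons.prems by auto
  then show ?case using Cons.IH hop_last_inject w' by metis
qed

text \<open>Hopping permutes letters, so the \<open>V\<close>-contribution of \<open>y\<close> is
  right from the start. Its \<open>U\<close>-contribution, the number of letters related to
  \<open>y\<close>, must become the length of \<open>w\<close> or 0, according to the letter before
  \<open>y\<close>. Hopping adds the number of unrelated letters in the first case and removes the
  number of related ones in the second.\<close>

lemma inv_stat_foata:
  assumes kappa: "kappa_extension X (U \<union> V) U" and disj: "U \<inter> V = {}" and "set w \<subseteq> X"
  shows "inv_stat (U \<union> V) (foata U w) = maj_stat U (rev w) + inv_stat V (rev w)"
  using assms(3)
proof (induction w)
  case (Cons y w)
  let ?S = "U \<union> V" and ?P = "\<lambda>x. (x, y) \<in> U" and ?v = "foata U w"
  have X: "y \<in> X" "set w \<subseteq> X" using Cons.prems by auto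
  have IH: "inv_stat ?S ?v = maj_stat U (rev w) + inv_stat V (rev w)" using Cons X by simp
  have len: "length (filter Q ?v) = length (filter Q w)" for Q
    by (metis mset_filter mset_foata size_mset)
  have set_v: "set ?v = set w" by (metis mset_foata set_mset_mset)
  have step: "(x, z) \<in> ?S \<and> (z, x) \<notin> ?S"
    if "x \<in> set ?v" "z \<in> set ?v" "(x, y) \<in> U" "(z, y) \<notin> U" for x z
    using kappa that X set_v unfolding kappa_extension_def by blast
  \<comment> \<open>Disjointness ensures that no letter is counted for both \<open>U\<close> and
    \<open>V\<close>.\<close>
  have len_S: "length (filter (\<lambda>x. (x, y) \<in> ?S) u)
      = length (filter ?P u) + length (filter (\<lambda>x. (x, y) \<in> V) u)" for u
    using disj by (induction u) auto
  have hop_len: "length (filter Q (hop_last ?P ?v)) = length (filter Q w)" for Q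
    by (metis mset_filter mset_hop_last mset_foata size_mset)
  have main: "inv_stat ?S (hop_last ?P ?v) + length (filter ?P w)
      = inv_stat ?S ?v + (if w = [] then 0 else length w * of_bool ((hd w, y) \<in> U))"
  proof (cases "w = []")
    case False
    then have lv: "last ?v = hd w" by (rule last_foata)
    show ?thesis
    proof (cases "(hd w, y) \<in> U")
      case True
      have "inv_stat ?S (hop ?P ?v) = inv_stat ?S ?v + length (filter (\<lambda>x. \<not> ?P x) ?v)"
        using step True lv by (intro inv_stat_hop_up) auto
      then show ?thesis
        using True lv False sum_length_filter_compl[of ?P w] by (simp add: hop_last_def len)
    next
      case nU: False
      \<comment> \<open>Here blocks end in unrelated letters, so the letters being passed are the
        related ones.\<close>
      have "inv_stat ?S (hop (\<lambda>x. \<not> ?P x) ?v) + length (filter (\<lambda>x. \<not> \<not> ?P x) ?v)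
          = inv_stat ?S ?v"
        using step nU lv by (intro inv_stat_hop_down) auto
      then show ?thesis using nU lv False by (simp add: hop_last_def len)
    qed
  qed (simp add: hop_last_def)
  have "inv_stat ?S (foata U (y # w))
      = inv_stat ?S (hop_last ?P ?v) + length (filter ?P w) + length (filter (\<lambda>x. (x, y) \<in> V) w)"
    by (simp add: inv_stat_snoc hop_len len_S del: Un_iff)
  also have "\<dots> = maj_stat U (rev w) + (if w = [] then 0 else length w * of_bool ((hd w, y) \<in> U))
      + (inv_stat V (rev w) + length (filter (\<lambda>x. (x, y) \<in> V) w))"
    using main IH by simp
  also have "maj_stat U (rev w) + (if w = [] then 0 else length w * of_bool ((hd w, y) \<in> U))
      = maj_stat U (rev (y # w))"
    by (simp add: maj_stat_snoc last_rev)
  also have "inv_stat V (rev w) + length (filter (\<lambda>x. (x, y) \<in> V) w) = inv_stat V (rev (y # w))"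
    by (simp add: inv_stat_snoc rev_filter[symmetric])
  finally show ?case .
qed simp

lemma equidistributed_if_kappa_extension:
  assumes "kappa_extension X (U \<union> V) U" "U \<inter> V = {}" "set_mset M \<subseteq> X"
  shows "equidistributed_on (permutations_of_multiset M)
           (\<lambda>w. maj_stat U w + inv_stat V w) (inv_stat (U \<union> V))"
proof -
  let ?R = "permutations_of_multiset M" and ?\<phi> = "\<lambda>w. foata U (rev w)"
  have inj: "inj_on ?\<phi> ?R" by (auto intro!: inj_onI dest: foata_inject)
  \<comment> \<open>An injective self-map of a finite class is onto.\<close>
  have "?\<phi> ` ?R = ?R"
    using inj by (intro endo_inj_surj finite_permutations_of_multiset)
      (auto simp: permutations_of_multiset_def)
  then have "(\<Sum>w\<in>?R. monom (1::int) (inv_stat (U \<union> V) w))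
      = (\<Sum>w\<in>?R. monom 1 (inv_stat (U \<union> V) (?\<phi> w)))"
    using sum.reindex[OF inj, of "\<lambda>w. monom (1::int) (inv_stat (U \<union> V) w)"]
    by (simp add: comp_def)
  also have "\<dots> = (\<Sum>w\<in>?R. monom 1 (maj_stat U w + inv_stat V w))"
  proof (rule sum.cong)
    fix w assume "w \<in> ?R"
    then have "set (rev w) \<subseteq> X"
      using assms(3) by (metis permutations_of_multisetD set_mset_mset set_rev)
    then show "monom (1::int) (inv_stat (U \<union> V) (?\<phi> w)) = monom 1 (maj_stat U w + inv_stat V w)"
      using inv_stat_foata[OF assms(1,2)] by simp
  qed simp
  finally show ?thesis by (simp add: equidistributed_on_def)
qed

section \<open>Moments on short words\<close>

lemma permutations_of_multiset_pair:
  "permutations_of_multiset {#x, y#} = {[x, y], [y, x]}"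
proof -
  have "{#x, y#} - {#x#} = {#y#}" "{#x, y#} - {#y#} = {#x#}" by simp_all
  then have "permutations_of_multiset {#x, y#}
      = (#) x ` permutations_of_multiset {#y#} \<union> (#) y ` permutations_of_multiset {#x#}"
    by (subst permutations_of_multiset_nonempty) simp_all
  then show ?thesis by auto
qed

lemma permutations_of_multiset_triple:
  "permutations_of_multiset {#x, y, z#}
     = {[x, y, z], [x, z, y], [y, x, z], [y, z, x], [z, x, y], [z, y, x]}"
proof -
  have "{#x, y, z#} - {#x#} = {#y, z#}" "{#x, y, z#} - {#y#} = {#x, z#}"
    "{#x, y, z#} - {#z#} = {#x, y#}"
    by (simp_all add: multiset_eq_iff)
  then have "permutations_of_multiset {#x, y, z#}
      = (#) x ` permutations_of_multiset {#y, z#} \<union> ((#) y ` permutations_of_multiset {#x, z#}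
        \<union> (#) z ` permutations_of_multiset {#x, y#})"
    by (subst permutations_of_multiset_nonempty) simp_all
  then show ?thesis by (auto simp: permutations_of_multiset_pair)
qed

lemma inv_stat_pair: "inv_stat S [a, b] = of_bool ((a, b) \<in> S)"
  by (simp add: inv_stat_Cons)

lemma inv_stat_triple:
  "inv_stat S [a, b, c] = of_bool ((a, b) \<in> S) + of_bool ((a, c) \<in> S) + of_bool ((b, c) \<in> S)"
  by (simp add: inv_stat_Cons)

lemma maj_stat_pair: "maj_stat U [a, b] = of_bool ((a, b) \<in> U)"
  using maj_stat_snoc[of "[a]" U b] by simp

lemma maj_stat_triple:
  "maj_stat U [a, b, c] = of_bool ((a, b) \<in> U) + 2 * of_bool ((b, c) \<in> U)"
  using maj_stat_snoc[of "[a, b]" U c] by (simp add: maj_stat_pair)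

section \<open>Necessity of the two conditions, from first and second moments\<close>

lemma disjoint_if_equidistributed:
  assumes "U \<subseteq> X \<times> X"
    and equi: "\<And>M. set_mset M \<subseteq> X \<Longrightarrow> equidistributed_on (permutations_of_multiset M)
                 (\<lambda>w. maj_stat U w + inv_stat V w) (inv_stat (U \<union> V))"
  shows "U \<inter> V = {}"
proof -
  have False if xy: "(x, y) \<in> U" "(x, y) \<in> V" for x y
  proof -
    have "x \<in> X" "y \<in> X" using xy assms(1) by auto
    then have "equidistributed_on {[x, y], [y, x]}
        (\<lambda>w. maj_stat U w + inv_stat V w) (inv_stat (U \<union> V))"
      using equi[of "{#x, y#}"] by (simp add: permutations_of_multiset_pair)
    from equidistributed_on_sum_eq[OF this, of int]
    have eq: "(\<Sum>w\<in>{[x, y], [y, x]}. int (maj_stat U w + inv_stat V w))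
        = (\<Sum>w\<in>{[x, y], [y, x]}. int (inv_stat (U \<union> V) w))" by simp
    \<comment> \<open>On two letters \<open>maj_stat\<close> and \<open>inv_stat\<close> coincide,
      so the sum counts a pair in both relations twice and is never the smaller statistic.\<close>
    have "inv_stat (U \<union> V) [y, x] \<le> maj_stat U [y, x] + inv_stat V [y, x]"
      by (simp add: inv_stat_pair maj_stat_pair)
    moreover have "inv_stat (U \<union> V) [x, y] < maj_stat U [x, y] + inv_stat V [x, y]"
      using xy by (simp add: inv_stat_pair maj_stat_pair)
    ultimately show False using eq by (cases "x = y") simp_all
  qed
  then show ?thesis by auto
qed

text \<open>This is d^2 - d*e with d and e in {-1, 0, 1}. It vanishes exactly if d = 0 or d = e, and
  d = e = 1 is the condition on \<open>S\<close> for x = \<open>a\<close>, y = \<open>c\<close>, z =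
  \<open>b\<close>.\<close>

definition kappa_defect :: "('a \<times> 'a) set \<Rightarrow> ('a \<times> 'a) set \<Rightarrow> 'a \<Rightarrow> 'a \<Rightarrow> 'a \<Rightarrow> int" where
  "kappa_defect U S a b c =
     (of_bool ((a, c) \<in> U) - of_bool ((b, c) \<in> U))\<^sup>2
     - (of_bool ((a, c) \<in> U) - of_bool ((b, c) \<in> U)) * (of_bool ((a, b) \<in> S) - of_bool ((b, a) \<in> S))"

lemma kappa_defect_nonneg: "kappa_defect U S a b c \<ge> 0"
  by (auto simp: kappa_defect_def of_bool_def)

lemma kappa_defect_eq_0D:
  "kappa_defect U S a b c = 0 \<Longrightarrow> (a, c) \<in> U \<Longrightarrow> (b, c) \<notin> U \<Longrightarrow> (a, b) \<in> S \<and> (b, a) \<notin> S"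
  by (auto simp: kappa_defect_def of_bool_def split: if_splits)

lemma kappa_defect_commute: "kappa_defect U S a b c = kappa_defect U S b a c"
  by (auto simp: kappa_defect_def of_bool_def)

lemma kappa_defect_self [simp]: "kappa_defect U S a a c = 0"
  by (simp add: kappa_defect_def)

text \<open>\<open>maj_stat\<close> weights the pair \<open>(b, c)\<close> by two and ignores
  \<open>(a, c)\<close>, which gives the last bracket.\<close>

lemma maj_inv_triple:
  assumes "U \<inter> V = {}"
  shows "int (maj_stat U [a, b, c] + inv_stat V [a, b, c])
    = of_bool ((a, b) \<in> U \<union> V) + of_bool ((a, c) \<in> U \<union> V) + of_bool ((b, c) \<in> U \<union> V)
      + (of_bool ((b, c) \<in> U) - of_bool ((a, c) \<in> U))"
proof -
  have "of_bool (p \<in> U \<union> V) = (of_bool (p \<in> U) + of_bool (p \<in> V) :: int)" for p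
    using assms by auto
  then show ?thesis by (simp add: maj_stat_triple inv_stat_triple del: Un_iff)
qed

text \<open>Swapping the first two letters reverses the sign of the correction in
  \<open>maj_inv_triple\<close>. First moments over the two words therefore agree, and squares are
  the first to show a difference.\<close>

lemma squares_of_swapped_words:
  assumes "U \<inter> V = {}"
  defines "s \<equiv> \<lambda>w. maj_stat U w + inv_stat V w" and "t \<equiv> inv_stat (U \<union> V)"
  shows "(int (s [a, b, c]))\<^sup>2 + (int (s [b, a, c]))\<^sup>2
    = (int (t [a, b, c]))\<^sup>2 + (int (t [b, a, c]))\<^sup>2 + 2 * kappa_defect U (U \<union> V) a b c"
proof -
  \<comment> \<open>\<open>p\<close>, \<open>q\<close>, \<open>e\<close>, \<open>f\<close> stand for
    the indicators of \<open>(a, b)\<close>, \<open>(b, a)\<close>, \<open>(a, c)\<close>,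
    \<open>(b, c)\<close> in the union, and \<open>u\<close>, \<open>v\<close> for those of
    \<open>(a, c)\<close>, \<open>(b, c)\<close> in \<open>U\<close>.\<close>
  have identity: "(p + e + f + (v - u))\<^sup>2 + (q + f + e + (u - v))\<^sup>2
      = (p + e + f)\<^sup>2 + (q + f + e)\<^sup>2 + 2 * ((u - v)\<^sup>2 - (u - v) * (p - q))" for p q e f u v :: int
    by (simp add: power2_eq_square algebra_simps)
  have "int (t [x, y, z])
      = of_bool ((x, y) \<in> U \<union> V) + of_bool ((x, z) \<in> U \<union> V) + of_bool ((y, z) \<in> U \<union> V)" for x y z
    by (simp add: t_def inv_stat_triple del: Un_iff)
  then show ?thesis
    unfolding s_def maj_inv_triple[OF assms(1)] kappa_defect_def by (simp only: identity)
qed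

lemma kappa_extension_if_equidistributed:
  assumes disj: "U \<inter> V = {}"
    and equi: "\<And>M. set_mset M \<subseteq> X \<Longrightarrow> equidistributed_on (permutations_of_multiset M)
                 (\<lambda>w. maj_stat U w + inv_stat V w) (inv_stat (U \<union> V))"
  shows "kappa_extension X (U \<union> V) U"
proof -
  let ?S = "U \<union> V"
  define f where "f = (\<lambda>w. (int (maj_stat U w + inv_stat V w))\<^sup>2)"
  define g where "g = (\<lambda>w. (int (inv_stat ?S w))\<^sup>2)"
  have moment: "sum f (permutations_of_multiset M) = sum g (permutations_of_multiset M)"
    if "set_mset M \<subseteq> X" for M
    using equidistributed_on_sum_eq[OF equi[OF that], of "\<lambda>k. (int k)\<^sup>2"]
    by (simp add: f_def g_def)
  have swap: "f [a, b, c] + f [b, a, c]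
      = g [a, b, c] + g [b, a, c] + 2 * kappa_defect U ?S a b c" for a b c
    unfolding f_def g_def by (rule squares_of_swapped_words[OF disj])
  have distinct: "kappa_defect U ?S x z y = 0"
    if X: "x \<in> X" "y \<in> X" "z \<in> X" and ne: "x \<noteq> y" "x \<noteq> z" "y \<noteq> z" for x y z
  proof -
    \<comment> \<open>The six words are paired by their last letter; each pair contributes one
      defect.\<close>
    have "sum h (permutations_of_multiset {#x, y, z#})
        = (h [x, y, z] + h [y, x, z]) + (h [x, z, y] + h [z, x, y]) + (h [y, z, x] + h [z, y, x])"
      for h :: "'a list \<Rightarrow> int"
      using ne by (simp add: permutations_of_multiset_triple)
    then have "kappa_defect U ?S x y z + kappa_defect U ?S x z y + kappa_defect U ?S y z x = 0"
      using moment[of "{#x, y, z#}"] X swap[of x y z] swap[of x z y] swap[of y z x] by simp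
    moreover have "kappa_defect U ?S x y z \<ge> 0" "kappa_defect U ?S x z y \<ge> 0"
      "kappa_defect U ?S y z x \<ge> 0"
      by (rule kappa_defect_nonneg)+
    ultimately show ?thesis by linarith
  qed
  have repeated: "kappa_defect U ?S y z y = 0" if X: "y \<in> X" "z \<in> X" and ne: "y \<noteq> z" for y z
  proof -
    \<comment> \<open>Only three words remain: the first is its own swap and has defect 0, and the
      other two form a swapped pair.\<close>
    have "sum h (permutations_of_multiset {#y, y, z#}) = h [y, y, z] + (h [y, z, y] + h [z, y, y])"
      for h :: "'a list \<Rightarrow> int"
    proof -
      have "permutations_of_multiset {#y, y, z#} = {[y, y, z], [y, z, y], [z, y, y]}"
        by (auto simp: permutations_of_multiset_triple)
      then show ?thesis using ne by simp
    qed
    then show ?thesis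
      using moment[of "{#y, y, z#}"] X swap[of y y z] swap[of y z y] by simp
  qed
  have "(x, z) \<in> ?S \<and> (z, x) \<notin> ?S"
    if X: "x \<in> X" "y \<in> X" "z \<in> X" and U: "(x, y) \<in> U" "(z, y) \<notin> U" for x y z
  proof -
    have ne: "x \<noteq> z" using U by auto
    \<comment> \<open>The letter \<open>y\<close> may coincide with \<open>x\<close> or
      \<open>z\<close>; the class then has a repeated letter.\<close>
    consider "y = x" | "y = z" | "x \<noteq> y" "y \<noteq> z" by blast
    then have "kappa_defect U ?S x z y = 0"
    proof cases
      case 1
      then show ?thesis using repeated[OF X(1,3)] ne by simp
    next
      case 2
      then show ?thesis
        using repeated[OF X(3,1)] ne by (subst kappa_defect_commute) simp
    next
      case 3
      then show ?thesis using distinct[OF X] ne by simp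
    qed
    then show ?thesis using U by (rule kappa_defect_eq_0D)
  qed
  then show ?thesis unfolding kappa_extension_def by blast
qed

theorem theorem1p7:
  fixes r :: nat and X :: "nat set" and U V :: "(nat \<times> nat) set"
  assumes "r \<ge> 1"
    and "X = {1..r}"
    and "U \<subseteq> X \<times> X"
    and "V \<subseteq> X \<times> X"
  shows "(\<forall>c :: nat \<Rightarrow> nat.
            equidistributed_on (rearrangement_class r c)
              (\<lambda>w. maj_stat U w + inv_stat V w) (inv_stat (U \<union> V)))
         \<longleftrightarrow> U \<inter> V = {} \<and> kappa_extension X (U \<union> V) U"
proof
  assume "\<forall>c. equidistributed_on (rearrangement_class r c)
            (\<lambda>w. maj_stat U w + inv_stat V w) (inv_stat (U \<union> V))"
  \<comment> \<open>Taking \<open>c\<close> to be \<open>count M\<close> reaches every multiset over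
    the alphabet.\<close>
  then have equi: "equidistributed_on (permutations_of_multiset M)
      (\<lambda>w. maj_stat U w + inv_stat V w) (inv_stat (U \<union> V))" if "set_mset M \<subseteq> X" for M
    using rearrangement_class_count[of M r] that assms(2) by (metis (no_types))
  have "U \<inter> V = {}" using assms(3) equi by (rule disjoint_if_equidistributed)
  then show "U \<inter> V = {} \<and> kappa_extension X (U \<union> V) U"
    using kappa_extension_if_equidistributed[OF _ equi] by simp
next
  assume "U \<inter> V = {} \<and> kappa_extension X (U \<union> V) U"
  then show "\<forall>c. equidistributed_on (rearrangement_class r c)
      (\<lambda>w. maj_stat U w + inv_stat V w) (inv_stat (U \<union> V))"
    using set_mset_rearrangement assms(2)
    by (auto simp only: rearrangement_class_def intro!: equidistributed_if_kappa_extension)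
qed

end
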